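(* Let $K>1$, $\alpha>0$ and $\beta>0$ be real constants such that $$\beta<\tfrac14\alpha^2K^2\quad\text{when } \alpha<2\left(1-\tfrac1K\right),$$ $$\beta<(K-1)(\alpha K-K+1)\quad\text{when } \alpha\ge 2\left(1-\tfrac1K\right).$$ Let $h,f,g:\mathbb{R}\to\mathbb{R}$ be functions of class $C^1$ such that $$\inf_{x\in\mathbb{R}}|h'(x)|\ge K,\qquad \inf_{x\in\mathbb{R}}|f'(x)|\ge\alpha,\qquad \sup_{x\in\mathbb{R}}|g(x)|<+\infty,\qquad \sup_{x\in\mathbb{R}}|g'(x)|\le\beta.$$ Then there exists a function $\phi:\mathbb{R}\to\mathbb{R}$ of class $C^1$ with bounded derivative on $\mathbb{R}$ such that $$\phi^2(x)=h(\phi(f(x)))+g(x)\qquad\text{for all }x\in\mathbb{R}.$$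
   Context: Here $\phi^2$ denotes the second iterate of $\phi$, i.e. $\phi^2(x)=\phi(\phi(x))$ (not the square of $\phi(x)$). *)

theory Defs
  imports "HOL-Analysis.Analysis"
begin

end

theory Submission
  imports Defs
begin

text \<open>
  Both h and f are C1 diffeomorphisms of the line. With H and F their inverses, the equation is the
  fixed point equation T \<phi> = \<phi> for T \<phi> = H \<circ> (\<phi> \<circ> \<phi> \<circ> F - g \<circ> F). In the sup norm T contracts
  the bounded functions with Lipschitz constant L by the factor (1 + L) / K, and it preserves this
  class when L^2 + \<beta> \<le> \<alpha> K L; the bound on \<beta> says that such an L exists below both K - 1 and
  \<alpha> K / 2. The fixed point is C1 by fibre contraction: differentiating T along \<phi> gives a quadratic
  operator on candidate derivatives, which is a contraction with factor 2 L / (\<alpha> K) < 1, and the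
  derivatives of the iterates of T at 0 converge uniformly to its fixed point. Uniformity on the whole
  line comes from boundedness of \<phi> and g: H' and the limit derivative are only evaluated on compact sets.
\<close>

section \<open>Contractions in the uniform norm\<close>

text \<open>Banach's fixed point theorem by Picard iteration, with pointwise bounds playing the role
  of the sup metric. In this form it applies to any class of functions closed under uniform limits;
  it is used once for the solution and once for its derivative.\<close>

lemma uniform_contraction_fixpoint:
  fixes T :: "('a \<Rightarrow> 'b::complete_space) \<Rightarrow> 'a \<Rightarrow> 'b"
  assumes "u0 \<in> A" and T: "\<And>u. u \<in> A \<Longrightarrow> T u \<in> A"
    and diam: "\<And>u w x. u \<in> A \<Longrightarrow> w \<in> A \<Longrightarrow> dist (u x) (w x) \<le> B"
    and q: "0 \<le> q" "q < 1"
    and contr: "\<And>u w d. u \<in> A \<Longrightarrow> w \<in> A \<Longrightarrow> (\<And>x. dist (u x) (w x) \<le> d) \<Longrightarrow>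
                  (\<And>x. dist (T u x) (T w x) \<le> q * d)"
    and closed: "\<And>s u. (\<And>n. s n \<in> A) \<Longrightarrow> uniform_limit UNIV s u sequentially \<Longrightarrow> u \<in> A"
  obtains u where "u \<in> A" "T u = u" "uniform_limit UNIV (\<lambda>n. (T ^^ n) u0) u sequentially"
proof -
  define s where "s = (\<lambda>n. (T ^^ n) u0)"
  have s: "s n \<in> A" for n
    unfolding s_def by (induction n) (auto simp: \<open>u0 \<in> A\<close> T)
  have s_Suc: "s (Suc n) = T (s n)" for n
    by (simp add: s_def)
  \<comment> \<open>The orbit is compared with its own shift: \<open>B\<close> bounds the gap
    between \<open>s k\<close> and \<open>s 0\<close>, and \<open>m\<close> applications of
    \<open>T\<close> shrink it by \<open>q ^ m\<close>. No geometric series has to be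
    summed.\<close>
  have geom: "dist (s (m + k) x) (s m x) \<le> q ^ m * B" for m k x
  proof (induction m arbitrary: x)
    case 0
    show ?case using diam[OF s s] by simp
  next
    case (Suc m)
    show ?case using contr[OF s s Suc] by (simp add: s_Suc mult.assoc)
  qed
  have "uniformly_Cauchy_on UNIV s"
  proof (rule uniformly_Cauchy_onI')
    fix e :: real assume "e > 0"
    have "(\<lambda>m. q ^ m * B) \<longlonglongrightarrow> 0 * B"
      by (intro tendsto_intros LIMSEQ_power_zero) (use q in auto)
    then have "\<forall>\<^sub>F m in sequentially. q ^ m * B < e"
      using \<open>e > 0\<close> by (intro order_tendstoD) auto
    then obtain M where M: "\<And>m. m \<ge> M \<Longrightarrow> q ^ m * B < e"
      by (auto simp: eventually_sequentially)
    have "dist (s m x) (s n x) < e" if "m \<ge> M" "n > m" for m n x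
      using geom[of m "n - m" x] M[OF that(1)] that by (simp add: dist_commute)
    then show "\<exists>M. \<forall>x\<in>UNIV. \<forall>m\<ge>M. \<forall>n>m. dist (s m x) (s n x) < e"
      by blast
  qed
  then obtain u where u: "uniform_limit UNIV s u sequentially"
    using Cauchy_uniformly_convergent uniformly_convergent_on_def by blast
  have "u \<in> A"
    using closed[OF s u] .
  \<comment> \<open>Both \<open>u x\<close> and \<open>T u x\<close> are limits of the shifted orbit
    at \<open>x\<close>, the latter because the contraction estimate carries uniform closeness of
    \<open>s n\<close> to \<open>u\<close> over to their images.\<close>
  have "T u x = u x" for x
  proof (rule LIMSEQ_unique)
    show "(\<lambda>n. s (Suc n) x) \<longlonglongrightarrow> u x"
      by (rule LIMSEQ_Suc[OF tendsto_uniform_limitI[OF u]]) simp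
    show "(\<lambda>n. s (Suc n) x) \<longlonglongrightarrow> T u x"
    proof (rule metric_LIMSEQ_I)
      fix e :: real assume "e > 0"
      then obtain N where N: "\<And>n x. n \<ge> N \<Longrightarrow> dist (s n x) (u x) < e"
        using uniform_limitD[OF u \<open>e > 0\<close>] by (auto simp: eventually_sequentially)
      have "dist (s (Suc n) x) (T u x) < e" if "n \<ge> N" for n
      proof -
        have "dist (s (Suc n) x) (T u x) \<le> q * e"
          unfolding s_Suc by (rule contr[OF s \<open>u \<in> A\<close>]) (use N[OF that] less_imp_le in blast)
        also have "\<dots> < e" using q \<open>e > 0\<close> by simp
        finally show ?thesis .
      qed
      then show "\<exists>N. \<forall>n\<ge>N. dist (s (Suc n) x) (T u x) < e" by blast
    qed
  qed
  then have "T u = u" by blast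
  with \<open>u \<in> A\<close> u show ?thesis using that by (simp add: s_def)
qed

text \<open>The fibre half of the fibre contraction argument. Here \<open>z n\<close> stands for the
  image of \<open>v\<close> under the map that takes \<open>w n\<close> to \<open>w (Suc n)\<close>;
  the maps vary with \<open>n\<close> but share the factor \<open>q\<close>. The error is thus
  multiplied by \<open>q\<close> and increased by the vanishing distance from \<open>z n\<close> to
  \<open>v\<close>, so it tends to 0.\<close>

lemma uniform_limit_perturbed_contraction:
  fixes w :: "nat \<Rightarrow> 'a \<Rightarrow> 'b::metric_space"
  assumes q: "0 \<le> q" "q < 1"
    and bnd: "\<And>n x. dist (w n x) (v x) \<le> C"
    and step: "\<And>n d. (\<And>x. dist (w n x) (v x) \<le> d) \<Longrightarrow> (\<And>x. dist (w (Suc n) x) (z n x) \<le> q * d)"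
    and z: "uniform_limit UNIV z v sequentially"
  shows "uniform_limit UNIV w v sequentially"
proof (rule uniform_limitI)
  fix e :: real assume "e > 0"
  \<comment> \<open>The tolerance is chosen so that \<open>e / 2\<close> is the fixed point of the
    error recursion, which maps \<open>d\<close> to \<open>q * d + (1 - q) * (e / 2)\<close>; only
    the excess over \<open>e / 2\<close> has to decay.\<close>
  then have "(1 - q) * (e / 2) > 0" using q by simp
  from uniform_limitD[OF z this] obtain N
    where N: "\<And>n x. n \<ge> N \<Longrightarrow> dist (z n x) (v x) < (1 - q) * (e / 2)"
    by (auto simp: eventually_sequentially)
  have decay: "dist (w (N + k) x) (v x) \<le> q ^ k * C + e / 2" for k x
  proof (induction k arbitrary: x)
    case 0
    show ?case using bnd[of N x] \<open>e > 0\<close> by simp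
  next
    case (Suc k)
    have "dist (w (N + Suc k) x) (v x) \<le> dist (w (Suc (N + k)) x) (z (N + k) x) + dist (z (N + k) x) (v x)"
      by (simp add: dist_triangle)
    also have "\<dots> \<le> q * (q ^ k * C + e / 2) + (1 - q) * (e / 2)"
      using step[OF Suc] N[of "N + k" x] by (intro add_mono) auto
    also have "\<dots> = q ^ Suc k * C + e / 2"
      by (simp add: field_simps)
    finally show ?case .
  qed
  have "(\<lambda>k. q ^ k * C) \<longlonglongrightarrow> 0 * C"
    by (intro tendsto_intros LIMSEQ_power_zero) (use q in auto)
  then have "\<forall>\<^sub>F k in sequentially. q ^ k * C < e / 2"
    using \<open>e > 0\<close> by (intro order_tendstoD) auto
  then obtain M where M: "\<And>k. k \<ge> M \<Longrightarrow> q ^ k * C < e / 2"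
    by (auto simp: eventually_sequentially)
  have "dist (w n x) (v x) < e" if "n \<ge> N + M" for n x
  proof -
    have "q ^ (n - N) * C < e / 2" using that by (intro M) simp
    then show ?thesis using decay[of "n - N" x] that by simp
  qed
  then show "\<forall>\<^sub>F n in sequentially. \<forall>x\<in>UNIV. dist (w n x) (v x) < e"
    by (auto simp: eventually_sequentially)
qed

section \<open>Global inverses of C1 maps with derivative bounded away from zero\<close>

text \<open>By the mean value theorem \<open>f\<close> expands distances by at least
  \<open>a\<close>. This makes it injective with Lipschitz inverse, and its range both open and
  closed, hence the whole line.\<close>

lemma C1_inverse_real:
  fixes f f' :: "real \<Rightarrow> real"
  assumes f: "\<And>x. (f has_real_derivative f' x) (at x)"
    and cont: "continuous_on UNIV f'"
    and "a > 0" and lb: "\<And>x. a \<le> \<bar>f' x\<bar>"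
  obtains F F' where "\<And>x. F (f x) = x" "\<And>y. f (F y) = y"
    "\<And>y. (F has_real_derivative F' y) (at y)" "continuous_on UNIV F'" "\<And>y. \<bar>F' y\<bar> \<le> 1 / a"
proof -
  have expand: "a * \<bar>x - y\<bar> \<le> \<bar>f x - f y\<bar>" for x y
  proof -
    have *: "a * \<bar>x - y\<bar> \<le> \<bar>f x - f y\<bar>" if xy: "x < y" for x y
    proof -
      obtain c where "f y - f x = (y - x) * f' c"
        using MVT2[OF xy f] by blast
      then have "\<bar>f x - f y\<bar> = \<bar>f' c\<bar> * \<bar>x - y\<bar>"
        by (metis abs_minus_commute abs_mult mult.commute)
      then show ?thesis
        using lb[of c] by (simp add: mult_right_mono)
    qed
    show ?thesis
      using *[of x y] *[of y x] by (cases x y rule: linorder_cases) (auto simp: abs_minus_commute)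
  qed
  have cont_f: "continuous_on UNIV f"
    using f DERIV_isCont continuous_at_imp_continuous_on by blast
  have "inj f"
  proof (rule injI)
    fix x y assume "f x = f y"
    with expand[of x y] \<open>a > 0\<close> show "x = y" by (simp add: mult_le_0_iff)
  qed
  have "open (range f)"
    using invariance_of_domain[OF cont_f open_UNIV \<open>inj f\<close>] .
  \<comment> \<open>Expansion makes the preimages of a convergent sequence Cauchy, and the image of
    their limit is the limit of the sequence.\<close>
  moreover have "closed (range f)"
    unfolding closed_sequential_limits
  proof (intro allI impI, elim conjE)
    fix s l assume s: "\<forall>n. s n \<in> range f" and l: "s \<longlonglongrightarrow> l"
    define t where "t = (\<lambda>n. inv f (s n))"
    have t: "s n = f (t n)" for n
      using s by (simp add: t_def f_inv_into_f)
    have "Cauchy t"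
    proof (rule metric_CauchyI)
      fix e :: real assume "e > 0"
      then have "a * e > 0" using \<open>a > 0\<close> by simp
      then obtain M where M: "\<And>m n. m \<ge> M \<Longrightarrow> n \<ge> M \<Longrightarrow> dist (s m) (s n) < a * e"
        using LIMSEQ_imp_Cauchy[OF l] metric_CauchyD by blast
      have "dist (t m) (t n) < e" if "m \<ge> M" "n \<ge> M" for m n
      proof -
        have "a * dist (t m) (t n) < a * e"
          using M[OF that] expand[of "t m" "t n"] by (simp add: t dist_real_def)
        then show ?thesis using \<open>a > 0\<close> by simp
      qed
      then show "\<exists>M. \<forall>m\<ge>M. \<forall>n\<ge>M. dist (t m) (t n) < e" by blast
    qed
    then obtain x where "t \<longlonglongrightarrow> x"
      using Cauchy_convergent_iff convergent_def by blast
    then have "(\<lambda>n. f (t n)) \<longlonglongrightarrow> f x"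
      using cont_f by (simp add: continuous_on_eq_continuous_at isCont_tendsto_compose)
    then have "l = f x"
      using LIMSEQ_unique[OF l] by (simp flip: t)
    then show "l \<in> range f" by blast
  qed
  ultimately have "surj f"
    using connected_UNIV clopen by blast
  define F where "F = inv f"
  have Ff: "F (f x) = x" and fF: "f (F y) = y" for x y
    using \<open>inj f\<close> \<open>surj f\<close> by (simp_all add: F_def surj_f_inv_f)
  have "(1 / a)-lipschitz_on UNIV F"
  proof (rule lipschitz_onI)
    show "dist (F y) (F z) \<le> 1 / a * dist y z" for y z
      using expand[of "F y" "F z"] \<open>a > 0\<close> by (simp add: fF dist_real_def field_simps)
  qed (use \<open>a > 0\<close> in auto)
  then have cont_F: "continuous_on UNIV F"
    by (rule lipschitz_on_continuous_on)
  have nz: "f' x \<noteq> 0" for x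
    using lb[of x] \<open>a > 0\<close> by auto
  show ?thesis
  proof (rule that[of F "\<lambda>y. inverse (f' (F y))"])
    show "(F has_real_derivative inverse (f' (F y))) (at y)" for y
      using f nz cont_F fF
      by (intro has_field_derivative_inverse_basic[where f = f and t = UNIV])
         (auto simp: continuous_on_eq_continuous_at)
    show "continuous_on UNIV (\<lambda>y. inverse (f' (F y)))"
      using nz by (intro continuous_intros continuous_on_compose2[OF cont cont_F]) auto
    show "\<bar>inverse (f' (F y))\<bar> \<le> 1 / a" for y
      using lb[of "F y"] \<open>a > 0\<close> by (simp add: divide_simps)
  qed (use Ff fF in auto)
qed

section \<open>The inverted equation: Lipschitz fixed point, then its derivative\<close>

text \<open>In the application \<open>p\<close>, \<open>r\<close> and \<open>b\<close> are
  \<open>1 / K\<close>, \<open>1 / \<alpha>\<close> and \<beta>. The conditions on \<open>L\<close>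
  make the operator on functions a contraction, make the operator on derivatives a contraction, and
  keep the bound \<open>L\<close> invariant under both, in this order after nonnegativity.\<close>

lemma C1_solution_of_inverted_equation:
  fixes H H' F F' g g' :: "real \<Rightarrow> real" and p r b G L :: real
  assumes H: "\<And>x. (H has_real_derivative H' x) (at x)" "continuous_on UNIV H'" "\<And>x. \<bar>H' x\<bar> \<le> p"
    and F: "\<And>x. (F has_real_derivative F' x) (at x)" "continuous_on UNIV F'" "\<And>x. \<bar>F' x\<bar> \<le> r"
    and g: "\<And>x. (g has_real_derivative g' x) (at x)" "continuous_on UNIV g'" "\<And>x. \<bar>g' x\<bar> \<le> b"
    and G: "\<And>x. \<bar>g x\<bar> \<le> G"
    and L: "0 \<le> L" "p * (1 + L) < 1" "2 * L * (p * r) < 1" "p * r * (L\<^sup>2 + b) \<le> L"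
  obtains \<phi> v where "\<And>x. (\<phi> has_real_derivative v x) (at x)" "continuous_on UNIV v"
    "\<And>x. \<bar>v x\<bar> \<le> L" "\<And>x. \<phi> x = H (\<phi> (\<phi> (F x)) - g (F x))"
proof -
  have p: "p \<ge> 0" and r: "r \<ge> 0" and b: "b \<ge> 0"
    using H(3)[of 0] F(3)[of 0] g(3)[of 0] by linarith+
  have "p < 1"
    using L(1,2) p by (smt (verit) mult_left_mono mult_cancel_left1 mult_left_le)
  have lip: "\<bar>k x - k y\<bar> \<le> c * \<bar>x - y\<bar>"
    if "\<And>x. (k has_real_derivative k' x) (at x)" "\<And>x. \<bar>k' x\<bar> \<le> c" for k k' c x y
    using field_differentiable_bound[of UNIV k k' c x y] that by simp
  note lip_H = lip[OF H(1,3)] and lip_F = lip[OF F(1,3)] and lip_g = lip[OF g(1,3)]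
  \<comment> \<open>\<open>B\<close> solves the equation that balances the a priori bound on
    \<open>T u\<close> against the bound assumed for \<open>u\<close>, so the ball of radius
    \<open>B\<close> is invariant.\<close>
  define B where "B = (\<bar>H 0\<bar> + p * G) / (1 - p)"
  have B: "\<bar>H 0\<bar> + p * (B + G) = B"
    using \<open>p < 1\<close> by (simp add: B_def field_simps)
  have G0: "G \<ge> 0" using G[of 0] by linarith
  have B0: "B \<ge> 0" using \<open>p < 1\<close> p G0 by (simp add: B_def)
  define T where "T = (\<lambda>u x. H (u (u (F x)) - g (F x)))"
  define A where "A = {u. (\<forall>x y. \<bar>u x - u y\<bar> \<le> L * \<bar>x - y\<bar>) \<and> (\<forall>x. \<bar>u x\<bar> \<le> B)}"
  have A_lip: "\<bar>u x - u y\<bar> \<le> L * \<bar>x - y\<bar>" and A_bnd: "\<bar>u x\<bar> \<le> B" if "u \<in> A" for u x y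
    using that by (auto simp: A_def)
  have "(\<lambda>_. 0) \<in> A" using L(1) B0 by (simp add: A_def)
  moreover have T: "T u \<in> A" if u: "u \<in> A" for u
  proof -
    have "\<bar>T u x - T u y\<bar> \<le> L * \<bar>x - y\<bar>" for x y
    proof -
      have 1: "\<bar>u (u (F x)) - u (u (F y))\<bar> \<le> L * (L * \<bar>F x - F y\<bar>)"
        using A_lip[OF u, of "u (F x)" "u (F y)"] mult_left_mono[OF A_lip[OF u, of "F x" "F y"] L(1)]
        by linarith
      have "\<bar>T u x - T u y\<bar> \<le> p * \<bar>(u (u (F x)) - g (F x)) - (u (u (F y)) - g (F y))\<bar>"
        unfolding T_def by (rule lip_H)
      also have "\<dots> \<le> p * (L * (L * \<bar>F x - F y\<bar>) + b * \<bar>F x - F y\<bar>)"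
        using 1 lip_g[of "F x" "F y"] by (intro mult_left_mono p) linarith
      also have "\<dots> = p * (L\<^sup>2 + b) * \<bar>F x - F y\<bar>"
        by (simp add: algebra_simps power2_eq_square)
      also have "\<dots> \<le> p * (L\<^sup>2 + b) * (r * \<bar>x - y\<bar>)"
        using p b by (intro mult_left_mono lip_F) simp
      also have "\<dots> = p * r * (L\<^sup>2 + b) * \<bar>x - y\<bar>"
        by simp
      also have "\<dots> \<le> L * \<bar>x - y\<bar>"
        by (intro mult_right_mono L) simp
      finally show ?thesis .
    qed
    moreover have "\<bar>T u x\<bar> \<le> B" for x
    proof -
      have "\<bar>T u x - H 0\<bar> \<le> p * \<bar>(u (u (F x)) - g (F x)) - 0\<bar>"
        unfolding T_def by (rule lip_H)
      also have "\<dots> \<le> p * (B + G)"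
        using A_bnd[OF u, of "u (F x)"] G[of "F x"] by (intro mult_left_mono p) linarith
      finally show ?thesis using B by linarith
    qed
    ultimately show ?thesis by (simp add: A_def)
  qed
  moreover have "dist (u x) (w x) \<le> 2 * B" if "u \<in> A" "w \<in> A" for u w x
    using A_bnd[OF that(1), of x] A_bnd[OF that(2), of x] by (simp add: dist_real_def)
  moreover have "0 \<le> p * (1 + L)" "p * (1 + L) < 1"
    using p L by auto
  moreover have "dist (T u x) (T w x) \<le> p * (1 + L) * d"
    if u: "u \<in> A" and w: "w \<in> A" and d: "\<And>x. dist (u x) (w x) \<le> d" for u w d x
  proof -
    have d': "\<bar>u x - w x\<bar> \<le> d" for x
      using d[of x] by (simp add: dist_real_def)
    \<comment> \<open>Passing through \<open>u (w (F x))\<close> separates the change of the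
      argument, costing \<open>L * d\<close>, from the change of the function, costing
      \<open>d\<close>; hence the factor \<open>1 + L\<close>.\<close>
    have "\<bar>u (u (F x)) - u (w (F x))\<bar> \<le> L * d"
      using A_lip[OF u, of "u (F x)" "w (F x)"] mult_left_mono[OF d'[of "F x"] L(1)] by linarith
    then have 1: "\<bar>u (u (F x)) - w (w (F x))\<bar> \<le> (1 + L) * d"
      using d'[of "w (F x)"] by (simp add: algebra_simps)
    have "\<bar>T u x - T w x\<bar> \<le> p * \<bar>(u (u (F x)) - g (F x)) - (w (w (F x)) - g (F x))\<bar>"
      unfolding T_def by (rule lip_H)
    also have "\<dots> \<le> p * ((1 + L) * d)"
      using 1 by (intro mult_left_mono p) simp
    finally show ?thesis by (simp add: dist_real_def mult.assoc)
  qed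
  moreover have "u \<in> A" if s: "\<And>n. s n \<in> A" and lim: "uniform_limit UNIV s u sequentially" for s u
  proof -
    have l: "(\<lambda>n. s n x) \<longlonglongrightarrow> u x" for x
      by (rule tendsto_uniform_limitI[OF lim]) simp
    have "\<bar>u x\<bar> \<le> B" for x
      by (rule tendsto_le[OF _ tendsto_const tendsto_rabs[OF l]]) (use A_bnd[OF s] in auto)
    moreover have "\<bar>u x - u y\<bar> \<le> L * \<bar>x - y\<bar>" for x y
      by (rule tendsto_le[OF _ tendsto_const tendsto_rabs[OF tendsto_diff[OF l l]]])
         (use A_lip[OF s] in auto)
    ultimately show ?thesis by (simp add: A_def)
  qed
  ultimately obtain \<phi> where \<phi>: "\<phi> \<in> A" "T \<phi> = \<phi>"
    and lim: "uniform_limit UNIV (\<lambda>n. (T ^^ n) (\<lambda>_. 0)) \<phi> sequentially"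
    by (rule uniform_contraction_fixpoint[of "\<lambda>_. 0" A T "2 * B" "p * (1 + L)"])
  define s where "s = (\<lambda>n. (T ^^ n) (\<lambda>_. 0))"
  have s: "s n \<in> A" for n
    unfolding s_def by (induction n) (auto simp: T \<open>(\<lambda>_. 0) \<in> A\<close>)
  have s_Suc: "s (Suc n) = T (s n)" for n by (simp add: s_def)
  note lim = lim[folded s_def]
  \<comment> \<open>The chain rule applied to \<open>T u\<close>, with \<open>v\<close> in place of
    the derivative of \<open>u\<close>. It makes sense for candidates \<open>v\<close> that are not
    known to be derivatives.\<close>
  define S where "S = (\<lambda>u v x. H' (u (u (F x)) - g (F x)) * (v (u (F x)) * v (F x) - g' (F x)) * F' x)"
  have A_cont: "continuous_on UNIV u" if "u \<in> A" for u
    by (rule lipschitz_on_continuous_on[of L], rule lipschitz_onI)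
       (use A_lip[OF that] L(1) in \<open>auto simp: dist_real_def\<close>)
  have cF: "continuous_on UNIV F" and cg: "continuous_on UNIV g"
    using F(1) g(1) DERIV_isCont continuous_at_imp_continuous_on by blast+
  define V :: "(real \<Rightarrow> real) set" where "V = {v. continuous_on UNIV v \<and> (\<forall>x. \<bar>v x\<bar> \<le> L)}"
  \<comment> \<open>The estimate is uniform in the base \<open>u\<close>: it serves for the fixed
    point over \<phi> and for comparing derivatives along the iterates \<open>s n\<close>. The two
    factors of the product rule each contribute \<open>L * d\<close>.\<close>
  have S_contr: "dist (S u v x) (S u w x) \<le> 2 * L * (p * r) * d"
    if v: "\<And>x. \<bar>v x\<bar> \<le> L" and w: "\<And>x. \<bar>w x\<bar> \<le> L" and d: "\<And>x. dist (v x) (w x) \<le> d" for u v w d x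
  proof -
    let ?c = "u (F x)" and ?h = "H' (u (u (F x)) - g (F x))"
    have "v ?c * v (F x) - w ?c * w (F x) = (v ?c - w ?c) * v (F x) + w ?c * (v (F x) - w (F x))"
      by (simp add: algebra_simps)
    also have "\<bar>\<dots>\<bar> \<le> \<bar>v ?c - w ?c\<bar> * \<bar>v (F x)\<bar> + \<bar>w ?c\<bar> * \<bar>v (F x) - w (F x)\<bar>"
      by (metis abs_mult abs_triangle_ineq)
    also have "\<dots> \<le> d * L + L * d"
      using v w d L(1) order_trans[OF zero_le_dist d] by (intro add_mono mult_mono) (auto simp: dist_real_def)
    finally have 1: "\<bar>v ?c * v (F x) - w ?c * w (F x)\<bar> \<le> 2 * L * d"
      by simp
    have "S u v x - S u w x = ?h * (v ?c * v (F x) - w ?c * w (F x)) * F' x"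
      by (simp add: S_def algebra_simps)
    then have "\<bar>S u v x - S u w x\<bar> = \<bar>?h\<bar> * \<bar>v ?c * v (F x) - w ?c * w (F x)\<bar> * \<bar>F' x\<bar>"
      by (simp add: abs_mult)
    also have "\<dots> \<le> p * (2 * L * d) * r"
      using p r L(1) order_trans[OF zero_le_dist d] by (intro mult_mono H(3) F(3) 1) auto
    finally show ?thesis by (simp add: dist_real_def mult_ac)
  qed
  have S_bnd: "\<bar>S u v x\<bar> \<le> L" if v: "\<And>x. \<bar>v x\<bar> \<le> L" for u v x
  proof -
    let ?c = "u (F x)" and ?h = "H' (u (u (F x)) - g (F x))"
    have "\<bar>v ?c * v (F x)\<bar> \<le> L * L"
      unfolding abs_mult using L(1) by (intro mult_mono v) auto
    then have 1: "\<bar>v ?c * v (F x) - g' (F x)\<bar> \<le> L\<^sup>2 + b"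
      using g(3)[of "F x"] unfolding power2_eq_square by linarith
    have "\<bar>S u v x\<bar> = \<bar>?h\<bar> * \<bar>v ?c * v (F x) - g' (F x)\<bar> * \<bar>F' x\<bar>"
      by (simp add: abs_mult S_def)
    also have "\<dots> \<le> p * (L\<^sup>2 + b) * r"
      using p r b by (intro mult_mono H(3) F(3) 1) auto
    also have "\<dots> \<le> L" using L(4) by (simp add: mult_ac)
    finally show ?thesis .
  qed
  have "0 \<le> 2 * L * (p * r)"
    using p r L(1) by simp
  have S_cont: "continuous_on UNIV (S u v)" if u: "continuous_on UNIV u" and v: "continuous_on UNIV v" for u v
    unfolding S_def
    by (intro continuous_intros F(2) cF continuous_on_compose2[OF H(2)] continuous_on_compose2[OF v]
          continuous_on_compose2[OF u] continuous_on_compose2[OF cg] continuous_on_compose2[OF g(2)]) auto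
  have "(\<lambda>_. 0) \<in> V" using L(1) by (simp add: V_def)
  moreover have "S \<phi> v \<in> V" if "v \<in> V" for v
    using that S_bnd[of v \<phi>] S_cont[OF A_cont[OF \<phi>(1)], of v] by (simp add: V_def)
  moreover have "dist (u x) (w x) \<le> 2 * L" if "u \<in> V" "w \<in> V" for u w :: "real \<Rightarrow> real" and x
  proof -
    have "\<bar>u x\<bar> \<le> L" "\<bar>w x\<bar> \<le> L" using that by (auto simp: V_def)
    then show ?thesis by (simp add: dist_real_def)
  qed
  moreover note \<open>0 \<le> 2 * L * (p * r)\<close> L(3)
  moreover have "dist (S \<phi> v x) (S \<phi> w x) \<le> 2 * L * (p * r) * d"
    if "v \<in> V" "w \<in> V" "\<And>x. dist (v x) (w x) \<le> d" for v w d x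
    using that by (intro S_contr) (auto simp: V_def)
  moreover have "v \<in> V" if "\<And>n. w n \<in> V" and "uniform_limit UNIV w v sequentially" for w v
  proof -
    have "continuous_on UNIV v"
      by (rule uniform_limit_theorem[OF _ that(2)]) (use that(1) in \<open>auto simp: V_def\<close>)
    moreover have "\<bar>v x\<bar> \<le> L" for x
      by (rule tendsto_le[OF _ tendsto_const tendsto_rabs[OF tendsto_uniform_limitI[OF that(2)]]])
         (use that(1) in \<open>auto simp: V_def\<close>)
    ultimately show ?thesis by (simp add: V_def)
  qed
  ultimately obtain v where v: "v \<in> V" "S \<phi> v = v"
    by (rule uniform_contraction_fixpoint[of "\<lambda>_. 0" V "S \<phi>" "2 * L" "2 * L * (p * r)"])
  have v_cont: "continuous_on UNIV v" and v_bnd: "\<And>x. \<bar>v x\<bar> \<le> L"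
    using v by (auto simp: V_def)
  \<comment> \<open>These are the derivatives of the iterates \<open>s n\<close>; the start is the
    zero function, as is the derivative of \<open>s 0\<close>.\<close>
  define w where "w = rec_nat (\<lambda>_. 0) (\<lambda>n. S (s n))"
  have w_Suc: "w (Suc n) = S (s n) (w n)" for n by (simp add: w_def)
  have w_bnd: "\<bar>w n x\<bar> \<le> L" for n x
    by (induction n arbitrary: x) (use L(1) S_bnd in \<open>auto simp: w_def\<close>)
  have deriv_s: "(s n has_real_derivative w n x) (at x)" for n x
  proof (induction n arbitrary: x)
    case 0
    show ?case by (simp add: s_def w_def)
  next
    case (Suc n)
    have "((\<lambda>x. H (s n (s n (F x)) - g (F x))) has_real_derivative
        H' (s n (s n (F x)) - g (F x)) * (w n (s n (F x)) * (w n (F x) * F' x) - g' (F x) * F' x)) (at x)"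
      by (intro DERIV_chain2[OF H(1)] DERIV_diff DERIV_chain2[OF Suc] DERIV_chain2[OF g(1)] F(1))
    then show ?case
      unfolding s_Suc w_Suc by (simp add: T_def S_def algebra_simps)
  qed
  \<comment> \<open>Continuity in the base is needed only at the single fibre point
    \<open>v\<close>. As \<open>H'\<close> and \<open>v\<close> are merely continuous, it comes
    without a rate.\<close>
  have S_lim: "uniform_limit UNIV (\<lambda>n. S (s n) v) (S \<phi> v) sequentially"
  proof -
    have inner: "uniform_limit UNIV (\<lambda>n x. s n (F x)) (\<lambda>x. \<phi> (F x)) sequentially"
      by (rule uniform_limit_compose'[OF lim]) simp
    have outer: "uniform_limit UNIV (\<lambda>n x. s n (s n (F x)) - g (F x)) (\<lambda>x. \<phi> (\<phi> (F x)) - g (F x)) sequentially"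
    proof (rule uniform_limitI)
      fix e :: real assume "e > 0"
      then have "e / (1 + L) > 0" using L(1) by simp
      from uniform_limitD[OF lim this]
      show "\<forall>\<^sub>F n in sequentially. \<forall>x\<in>UNIV. dist (s n (s n (F x)) - g (F x)) (\<phi> (\<phi> (F x)) - g (F x)) < e"
      proof eventually_elim
        case (elim n)
        have d: "\<bar>s n x - \<phi> x\<bar> < e / (1 + L)" for x
          using elim by (simp add: dist_real_def)
        have "\<bar>s n (s n (F x)) - \<phi> (\<phi> (F x))\<bar> < e" for x
        proof -
          have "\<bar>\<phi> (s n (F x)) - \<phi> (\<phi> (F x))\<bar> \<le> L * (e / (1 + L))"
            using A_lip[OF \<phi>(1), of "s n (F x)" "\<phi> (F x)"] mult_left_mono[OF less_imp_le[OF d[of "F x"]] L(1)]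
            by linarith
          then have "\<bar>s n (s n (F x)) - \<phi> (\<phi> (F x))\<bar> < (1 + L) * (e / (1 + L))"
            using d[of "s n (F x)"] unfolding ring_distribs mult_1 by linarith
          also have "\<dots> = e" using L(1) by simp
          finally show ?thesis .
        qed
        then show ?case by (simp add: dist_real_def)
      qed
    qed
    \<comment> \<open>All values \<open>c n x\<close> lie in one compact interval, on which
      \<open>k\<close> is uniformly continuous. This is where boundedness of the iterates and of
      \<open>g\<close> enters.\<close>
    have cpt: "uniform_limit UNIV (\<lambda>n x. k (c n x)) (\<lambda>x. k (c' x)) sequentially"
      if k: "continuous_on UNIV k" and c: "uniform_limit UNIV c c' sequentially" "\<And>n x. \<bar>c n x\<bar> \<le> M"
      for k :: "real \<Rightarrow> real" and c :: "nat \<Rightarrow> real \<Rightarrow> real" and c' M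
    proof (rule uniform_limit_compose_uniformly_continuous_on[OF c(1), of "{-M..M}"])
      show "uniformly_continuous_on {-M..M} k"
        by (rule compact_uniformly_continuous) (use k continuous_on_subset in auto)
      show "\<forall>\<^sub>F n in sequentially. \<forall>x\<in>UNIV. c n x \<in> {-M..M}"
        using c(2) by (auto simp: abs_le_iff minus_le_iff)
    qed auto
    have "\<bar>s n (s n (F x)) - g (F x)\<bar> \<le> B + G" for n x
      using A_bnd[OF s, of n "s n (F x)"] G[of "F x"] by linarith
    note 1 = cpt[OF H(2) outer this]
    note 2 = cpt[OF v_cont inner A_bnd[OF s]]
    \<comment> \<open>Products preserve uniform convergence when the limits are bounded, so each
      factor and each partial product gets a bound.\<close>
    have bdd: "bounded (range k)" if "\<And>x. \<bar>k x\<bar> \<le> M" for k :: "real \<Rightarrow> real" and M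
      using that by (auto simp: bounded_iff)
    have vv: "\<bar>v x * v y\<bar> \<le> L * L" for x y
      unfolding abs_mult using L(1) by (intro mult_mono v_bnd) auto
    then have bv: "\<bar>v (\<phi> (F x)) * v (F x) - g' (F x)\<bar> \<le> L * L + b" for x
      using g(3)[of "F x"] vv[of "\<phi> (F x)" "F x"] by linarith
    have bh: "\<bar>H' (\<phi> (\<phi> (F x)) - g (F x)) * (v (\<phi> (F x)) * v (F x) - g' (F x))\<bar> \<le> p * (L * L + b)" for x
      unfolding abs_mult by (intro mult_mono H(3) bv p) simp
    note 3 = uniform_limit_minus[OF uniform_lim_mult[OF 2 uniform_limit_const bdd[OF v_bnd] bdd[OF v_bnd]]
        uniform_limit_const, of "\<lambda>x. F x" "\<lambda>x. g' (F x)"]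
    show ?thesis
      unfolding S_def
      by (rule uniform_lim_mult[OF uniform_lim_mult[OF 1 3 bdd[OF H(3)] bdd[OF bv]]
            uniform_limit_const bdd[OF bh] bdd[OF F(3)]])
  qed
  have "uniform_limit UNIV w v sequentially"
  proof (rule uniform_limit_perturbed_contraction[where z = "\<lambda>n. S (s n) v"])
    show "dist (w n x) (v x) \<le> 2 * L" for n x
      using w_bnd[of n x] v_bnd[of x] by (simp add: dist_real_def)
    show "dist (w (Suc n) x) (S (s n) v x) \<le> 2 * L * (p * r) * d" if "\<And>x. dist (w n x) (v x) \<le> d" for n d x
      unfolding w_Suc using that by (intro S_contr w_bnd v_bnd)
  qed (use \<open>0 \<le> 2 * L * (p * r)\<close> L(3) S_lim v(2) in simp_all)
  \<comment> \<open>Uniform convergence of the derivatives, with convergence of the iterates at one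
    point, lets differentiation pass to the limit; the resulting limit function is then identified
    with \<phi>.\<close>
  have "\<exists>\<psi>. \<forall>x\<in>UNIV. (\<lambda>n. s n x) \<longlonglongrightarrow> \<psi> x \<and> (\<psi> has_derivative (*) (v x)) (at x within UNIV)"
  proof (rule has_derivative_sequence[where f' = "\<lambda>n x. (*) (w n x)"])
    show "(s n has_derivative (*) (w n x)) (at x within UNIV)" for n x
      using deriv_s by (simp add: has_field_derivative_def)
    show "(\<lambda>n. s n 0) \<longlonglongrightarrow> \<phi> 0"
      by (rule tendsto_uniform_limitI[OF lim]) simp
    fix e :: real assume "e > 0"
    from uniform_limitD[OF \<open>uniform_limit UNIV w v sequentially\<close> this]
    show "\<forall>\<^sub>F n in sequentially. \<forall>x\<in>UNIV. \<forall>h. norm (w n x * h - v x * h) \<le> e * norm h"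
    proof eventually_elim
      case (elim n)
      then have "\<bar>w n x - v x\<bar> * \<bar>h\<bar> \<le> e * \<bar>h\<bar>" for x h
        by (intro mult_right_mono) (auto simp: dist_real_def less_imp_le)
      then show ?case by (simp add: abs_mult flip: left_diff_distrib)
    qed
  qed auto
  then obtain \<psi> where \<psi>: "\<And>x. (\<lambda>n. s n x) \<longlonglongrightarrow> \<psi> x" "\<And>x. (\<psi> has_real_derivative v x) (at x)"
    by (auto simp: has_field_derivative_def)
  have "\<psi> = \<phi>"
    using LIMSEQ_unique[OF \<psi>(1) tendsto_uniform_limitI[OF lim]] by auto
  show ?thesis
  proof (rule that[of \<phi> v])
    show "\<phi> x = H (\<phi> (\<phi> (F x)) - g (F x))" for x
      using fun_cong[OF \<phi>(2), of x] by (simp add: T_def)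
  qed (use \<psi>(2) \<open>\<psi> = \<phi>\<close> v_cont v_bnd in auto)
qed

section \<open>Choice of the Lipschitz constant and the original equation\<close>

lemma C1_differentiable_on_UNIV_real:
  "k C1_differentiable_on UNIV \<longleftrightarrow>
     (\<forall>x. (k has_real_derivative deriv k x) (at x)) \<and> continuous_on UNIV (deriv k)"
proof
  assume "k C1_differentiable_on UNIV"
  then obtain D where D: "\<And>x. (k has_real_derivative D x) (at x)" "continuous_on UNIV D"
    by (auto simp: C1_differentiable_on_def has_real_derivative_iff_has_vector_derivative)
  then have "deriv k = D"
    using DERIV_imp_deriv by blast
  with D show "(\<forall>x. (k has_real_derivative deriv k x) (at x)) \<and> continuous_on UNIV (deriv k)"
    by simp
qed (auto simp: C1_differentiable_on_def has_real_derivative_iff_has_vector_derivative)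

lemma lipschitz_constant_exists:
  fixes K \<alpha> \<beta> :: real
  assumes "K > 1" "\<alpha> > 0"
    and 1: "\<alpha> < 2 * (1 - 1 / K) \<Longrightarrow> \<beta> < 1 / 4 * \<alpha>\<^sup>2 * K\<^sup>2"
    and 2: "\<alpha> \<ge> 2 * (1 - 1 / K) \<Longrightarrow> \<beta> < (K - 1) * (\<alpha> * K - K + 1)"
  obtains L where "0 \<le> L" "L < K - 1" "2 * L < K * \<alpha>" "L\<^sup>2 + \<beta> \<le> L * (K * \<alpha>)"
proof -
  txt \<open>The strict inequality already holds at the forbidden endpoint M, so any L slightly below M works.\<close>
  define M where "M = min (K - 1) (K * \<alpha> / 2)"
  have "M > 0" using assms by (simp add: M_def)
  \<comment> \<open>The two regimes for \<alpha> decide which term of the minimum \<open>M\<close>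
    is the smaller one. Substituting that value into the quadratic inequality at \<open>M\<close>
    gives exactly the corresponding bound on \<beta>.\<close>
  have iff: "\<alpha> < 2 * (1 - 1 / K) \<longleftrightarrow> K * \<alpha> / 2 < K - 1"
    using \<open>K > 1\<close> by (simp add: field_simps)
  have "M\<^sup>2 + \<beta> < M * (K * \<alpha>)"
  proof (cases "\<alpha> < 2 * (1 - 1 / K)")
    case True
    then have M: "M = K * \<alpha> / 2" using iff by (simp add: M_def)
    show ?thesis using 1[OF True] unfolding M by (simp add: power2_eq_square field_simps)
  next
    case False
    then have M: "M = K - 1" using iff by (simp add: M_def)
    show ?thesis using 2 False unfolding M by (simp add: power2_eq_square algebra_simps)
  qed
  moreover have "((\<lambda>L. L * (K * \<alpha>) - (L\<^sup>2 + \<beta>)) \<longlongrightarrow> M * (K * \<alpha>) - (M\<^sup>2 + \<beta>)) (at_left M)"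
    by (intro tendsto_intros)
  ultimately have "\<forall>\<^sub>F L in at_left M. 0 < L * (K * \<alpha>) - (L\<^sup>2 + \<beta>)"
    by (intro order_tendstoD) auto
  moreover have "\<forall>\<^sub>F L in at_left M. L \<in> {0<..<M}"
    by (rule eventually_at_leftI[OF _ \<open>M > 0\<close>])
  ultimately have "\<forall>\<^sub>F L in at_left M. 0 \<le> L \<and> L < K - 1 \<and> 2 * L < K * \<alpha> \<and> L\<^sup>2 + \<beta> \<le> L * (K * \<alpha>)"
    by eventually_elim (auto simp: M_def)
  then show ?thesis
    using that eventually_happens'[OF trivial_limit_at_left_real] by blast
qed

theorem theorem2p1:
  fixes K \<alpha> \<beta> :: real and h f g :: "real \<Rightarrow> real"
  assumes "K > 1" and "\<alpha> > 0" and "\<beta> > 0"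
    and "\<alpha> < 2 * (1 - 1 / K) \<Longrightarrow> \<beta> < 1 / 4 * \<alpha>\<^sup>2 * K\<^sup>2"
    and "\<alpha> \<ge> 2 * (1 - 1 / K) \<Longrightarrow> \<beta> < (K - 1) * (\<alpha> * K - K + 1)"
    and "h C1_differentiable_on UNIV"
    and "f C1_differentiable_on UNIV"
    and "g C1_differentiable_on UNIV"
    and "(INF x. ereal \<bar>deriv h x\<bar>) \<ge> ereal K"
    and "(INF x. ereal \<bar>deriv f x\<bar>) \<ge> ereal \<alpha>"
    and "(SUP x. ereal \<bar>g x\<bar>) < \<infinity>"
    and "(SUP x. ereal \<bar>deriv g x\<bar>) \<le> ereal \<beta>"
  shows "\<exists>\<phi> :: real \<Rightarrow> real. \<phi> C1_differentiable_on UNIV \<and> bounded (range (deriv \<phi>)) \<and>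
    (\<forall>x. (\<phi> ^^ 2) x = h (\<phi> (f x)) + g x)"
proof -
  have lb_h: "K \<le> \<bar>deriv h x\<bar>" and lb_f: "\<alpha> \<le> \<bar>deriv f x\<bar>" and ub_g: "\<bar>deriv g x\<bar> \<le> \<beta>" for x
    using assms(9,10,12) by (auto simp: le_INF_iff SUP_le_iff)
  obtain G' where "(SUP x. ereal \<bar>g x\<bar>) \<le> ereal G'"
    using assms(11) by (auto simp: less_PInf_Ex_of_nat intro: less_imp_le)
  then have G: "\<bar>g x\<bar> \<le> G'" for x
    by (auto simp: SUP_le_iff)
  note C1 = assms(6-8)[unfolded C1_differentiable_on_UNIV_real]
  obtain H H' where H: "\<And>y. h (H y) = y" "\<And>y. (H has_real_derivative H' y) (at y)"
      "continuous_on UNIV H'" "\<And>y. \<bar>H' y\<bar> \<le> 1 / K"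
    by (rule C1_inverse_real[of h "deriv h" K]) (use C1(1) lb_h \<open>K > 1\<close> in auto)
  obtain F F' where F: "\<And>x. F (f x) = x" "\<And>y. (F has_real_derivative F' y) (at y)"
      "continuous_on UNIV F'" "\<And>y. \<bar>F' y\<bar> \<le> 1 / \<alpha>"
    by (rule C1_inverse_real[of f "deriv f" \<alpha>]) (use C1(2) lb_f \<open>\<alpha> > 0\<close> in auto)
  obtain L where L: "0 \<le> L" "L < K - 1" "2 * L < K * \<alpha>" "L\<^sup>2 + \<beta> \<le> L * (K * \<alpha>)"
    using lipschitz_constant_exists[OF assms(1,2,4,5)] by blast
  \<comment> \<open>The three inequalities for \<open>L\<close>, divided by \<open>K\<close> or by
    \<open>K * \<alpha>\<close>.\<close>
  have "1 / K * (1 + L) < 1" "2 * L * (1 / K * (1 / \<alpha>)) < 1" "1 / K * (1 / \<alpha>) * (L\<^sup>2 + \<beta>) \<le> L"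
    using L \<open>K > 1\<close> \<open>\<alpha> > 0\<close> by (simp_all add: field_simps)
  then obtain \<phi> v where \<phi>: "\<And>x. (\<phi> has_real_derivative v x) (at x)" "continuous_on UNIV v"
      "\<And>x. \<bar>v x\<bar> \<le> L" "\<And>x. \<phi> x = H (\<phi> (\<phi> (F x)) - g (F x))"
    using C1_solution_of_inverted_equation[OF H(2-4) F(2-4) conjunct1[OF C1(3), rule_format] conjunct2[OF C1(3)] ub_g G L(1)]
    by blast
  have "deriv \<phi> = v"
    using \<phi>(1) DERIV_imp_deriv by blast
  \<comment> \<open>Evaluation at \<open>f x\<close> cancels \<open>F\<close>, and applying
    \<open>h\<close> to both sides cancels \<open>H\<close>.\<close>
  have "(\<phi> ^^ 2) x = h (\<phi> (f x)) + g x" for x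
    using \<phi>(4)[of "f x"] by (simp add: F(1) H(1) numeral_2_eq_2)
  moreover have "\<phi> C1_differentiable_on UNIV"
    using \<phi>(1,2) \<open>deriv \<phi> = v\<close> by (simp add: C1_differentiable_on_UNIV_real)
  moreover have "bounded (range (deriv \<phi>))"
    using \<phi>(3) \<open>deriv \<phi> = v\<close> by (auto simp: bounded_iff)
  ultimately show ?thesis by blast
qed

end
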